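(* Let $X$ be a normed space, $C\subset X$ a pointed cone, $R>0$, and $C_R:=C\cap\overline{B_R(0_X)}$. Assume that the family of open slices (of $C_R$) containing $0_X$ forms a neighbourhood base for $0_X$ relative to $(C_R,\text{weak})$. Then $0_X$ is a locally weakly strongly extreme point of $C$.
   Context: Normed spaces are real and not assumed complete; $0_X$ is the origin; "weak" is the weak topology of $X$; $\overline{B_R(0_X)}$ is the closed ball of radius $R$ centred at $0_X$. A cone is a nonempty convex subset $C\subset X$ with $\alpha C\subset C$ for all real $\alpha\ge0$ (not assumed closed); it is pointed if $C\cap(-C)=\{0_X\}$. An open half space of $X$ is a set $\{x\in X: f(x)<\lambda\}$ with $f\in X^*\setminus\{0\}$ and $\lambda\in\mathbb{R}$. A slice (open slice) of a set $A\subset X$ is a nonempty intersection of $A$ with an open half space. For $A\subset X$, a point $x\in A$ is a locally weakly strongly extreme point of $A$ if there exists a neighbourhood $U$ of $x$ such that, given two sequences $(a_n)_n$ and $(a'_n)_n$ in $A\cap U$ with $\lim_n(a_n+a'_n)=2x$ (in norm), one has $\text{weak-}\lim_n a_n=x$. *)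

theory Defs
  imports "HOL-Analysis.Analysis"
begin

definition weak_topology :: "'a::real_normed_vector topology" where
  "weak_topology =
     topology_generated_by {blinfun_apply f -` V | (f :: 'a \<Rightarrow>\<^sub>L real) V. open V}"

lemma openin_weak_topology_vimage:
  fixes f :: "'a::real_normed_vector \<Rightarrow>\<^sub>L real"
  assumes "open V"
  shows "openin weak_topology (blinfun_apply f -` V)"
  unfolding weak_topology_def by (rule topology_generated_by_Basis) (use assms in blast)

lemma topspace_weak_topology [simp]:
  "topspace (weak_topology :: 'a::real_normed_vector topology) = UNIV"
  using openin_subset[OF openin_weak_topology_vimage[of UNIV "0 :: 'a \<Rightarrow>\<^sub>L real"]] by auto

definition pointed_cone :: "'a::real_normed_vector set \<Rightarrow> bool" where
  "pointed_cone C \<longleftrightarrow> convex_cone C \<and> C \<inter> uminus ` C = {0}"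

definition open_half_space :: "'a::real_normed_vector set \<Rightarrow> bool" where
  "open_half_space H \<longleftrightarrow>
     (\<exists>(f :: 'a \<Rightarrow>\<^sub>L real) l. f \<noteq> 0 \<and> H = {x. blinfun_apply f x < l})"

definition open_slice :: "'a::real_normed_vector set \<Rightarrow> 'a set \<Rightarrow> bool" where
  "open_slice A S \<longleftrightarrow> S \<noteq> {} \<and> (\<exists>H. open_half_space H \<and> S = A \<inter> H)"

(* neighbourhood_base_at only demands that the members of the family that are
   neighbourhoods form a base. By this lemma every open slice containing the
   point is a neighbourhood of it. *)
lemma openin_open_slice:
  assumes "open_slice A S"
  shows "openin (subtopology weak_topology A) S"
proof -
  obtain f :: "'a \<Rightarrow>\<^sub>L real" and l where S: "S = A \<inter> {x. blinfun_apply f x < l}"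
    using assms unfolding open_slice_def open_half_space_def by blast
  have "{x. blinfun_apply f x < l} = blinfun_apply f -` {..<l}"
    by auto
  then have "openin weak_topology {x. blinfun_apply f x < l}"
    using openin_weak_topology_vimage[of "{..<l}" f] by simp
  then show ?thesis
    unfolding S by (metis openin_subtopology_Int2)
qed

(* The neighbourhood U is taken in the norm topology. *)
definition locally_weakly_strongly_extreme_point ::
    "'a::real_normed_vector \<Rightarrow> 'a set \<Rightarrow> bool" where
  "locally_weakly_strongly_extreme_point x A \<longleftrightarrow>
     x \<in> A \<and>
     (\<exists>U. x \<in> interior U \<and>
        (\<forall>a a' :: nat \<Rightarrow> 'a.
           (\<forall>n. a n \<in> A \<inter> U) \<and> (\<forall>n. a' n \<in> A \<inter> U) \<and>
           (\<lambda>n. a n + a' n) \<longlonglongrightarrow> 2 *\<^sub>R x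
           \<longrightarrow> limitin weak_topology a x sequentially))"

end

theory Submission
  imports Defs
begin

text \<open>Put \<open>C\<^sub>R = C \<inter> cball 0 R\<close> and take this ball as the neighbourhood of the origin. Let
  \<open>a\<close> and \<open>b\<close> be sequences in \<open>C\<^sub>R\<close> with \<open>a n + b n \<longlonglongrightarrow> 0\<close>, let \<open>f\<close> be a bounded functional and
  \<open>e > 0\<close>. The base property puts a slice \<open>{x \<in> C\<^sub>R. g x < l}\<close> around the origin inside
  \<open>{x. \<bar>f x\<bar> < e}\<close>, and \<open>l > 0\<close> because the origin lies in the slice. The numbers
  \<open>g (a n) + g (b n)\<close> tend to \<open>0\<close>, so eventually they are below \<open>2 * l\<close>; hence for all large \<open>n\<close>
  at least one of \<open>a n\<close>, \<open>b n\<close> lies in the slice, and \<open>f\<close> is smaller than \<open>e\<close> there.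
  Since \<open>f (a n) + f (b n)\<close> also tends to \<open>0\<close>, smallness of \<open>f\<close> at either point forces
  \<open>\<bar>f (a n)\<bar> < 2 * e\<close>. So \<open>f (a n)\<close> tends to \<open>0\<close> for every \<open>f\<close>, which is weak convergence. The
  comparison of the two summands goes through the single functional \<open>g\<close>; this is where the base
  property enters, since a basic weak neighbourhood is bounded by finitely many functionals, and
  \<open>a n\<close> could violate one bound while \<open>b n\<close> violates another.\<close>

text \<open>The sets absorbing almost all terms of a sequence are closed under finite intersections and
  supersets, so it suffices to test the subbase that generates the weak topology.\<close>

lemma limitin_weak_topologyI:
  fixes a :: "nat \<Rightarrow> 'a::real_normed_vector"
  assumes "\<And>f :: 'a \<Rightarrow>\<^sub>L real. (\<lambda>n. f (a n)) \<longlonglongrightarrow> f x"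
  shows "limitin weak_topology a x sequentially"
proof -
  let ?B = "{blinfun_apply f -` V | (f :: 'a \<Rightarrow>\<^sub>L real) V. open V}"
  have "x \<in> U \<longrightarrow> (\<forall>\<^sub>F n in sequentially. a n \<in> U)"
    if "generate_topology_on ?B U" for U
    using that
  proof (induction rule: generate_topology_on.induct)
    case Empty
    show ?case by simp
  next
    case (Int U V)
    then show ?case by (auto intro: eventually_conj)
  next
    case (UN K)
    show ?case
    proof
      assume "x \<in> \<Union>K"
      then obtain k where k: "k \<in> K" "x \<in> k" by blast
      with UN.IH have "\<forall>\<^sub>F n in sequentially. a n \<in> k" by blast
      then show "\<forall>\<^sub>F n in sequentially. a n \<in> \<Union>K"
        by (rule eventually_mono) (use k in blast)
    qed
  next
    case (Basis U)
    then obtain f :: "'a \<Rightarrow>\<^sub>L real" and V where "open V" "U = blinfun_apply f -` V" by blast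
    then show ?case
      using topological_tendstoD[OF assms, of V f] by simp
  qed
  then show ?thesis
    unfolding limitin_def topspace_weak_topology
    unfolding weak_topology_def openin_topology_generated_by_iff by blast
qed

lemma slice_base_at_0_obtains_functional:
  fixes A :: "'a::real_normed_vector set" and f :: "'a \<Rightarrow>\<^sub>L real"
  assumes base: "neighbourhood_base_at 0 (\<lambda>S. open_slice A S \<and> 0 \<in> S)
                   (subtopology weak_topology A)"
    and "0 \<in> A" and "e > 0"
  obtains g :: "'a \<Rightarrow>\<^sub>L real" and l where "l > 0" "\<And>x. x \<in> A \<Longrightarrow> g x < l \<Longrightarrow> \<bar>f x\<bar> < e"
proof -
  let ?W = "A \<inter> blinfun_apply f -` {-e<..<e}"
  have "openin (subtopology weak_topology A) ?W"
    using openin_weak_topology_vimage[of "{-e<..<e}" f] by (simp add: openin_subtopology_Int2)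
  moreover have "0 \<in> ?W"
    using \<open>0 \<in> A\<close> \<open>e > 0\<close> by simp
  ultimately obtain S where S: "open_slice A S" "0 \<in> S" "S \<subseteq> ?W"
    using base unfolding neighbourhood_base_at_def by meson
  then obtain g :: "'a \<Rightarrow>\<^sub>L real" and l where gl: "S = A \<inter> {x. g x < l}"
    unfolding open_slice_def open_half_space_def by blast
  show thesis
  proof
    show "l > 0"
      using S(2) gl by simp
    show "\<bar>f x\<bar> < e" if "x \<in> A" "g x < l" for x
    proof -
      have "x \<in> ?W"
        using S(3) gl that by blast
      then show ?thesis
        by (simp add: abs_less_iff)
    qed
  qed
qed

text \<open>If the slice misses \<open>a n\<close>, it catches \<open>b n\<close>; since \<open>b n\<close> is close to \<open>- a n\<close>, this
  controls \<open>f (a n)\<close> equally well.\<close>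

lemma functional_tendsto_0_if_slice_base:
  fixes A :: "'a::real_normed_vector set" and f :: "'a \<Rightarrow>\<^sub>L real"
  assumes base: "neighbourhood_base_at 0 (\<lambda>S. open_slice A S \<and> 0 \<in> S)
                   (subtopology weak_topology A)"
    and "0 \<in> A" and A: "\<And>n. a n \<in> A" "\<And>n. b n \<in> A"
    and lim: "(\<lambda>n. a n + b n) \<longlonglongrightarrow> 0"
  shows "(\<lambda>n. f (a n)) \<longlonglongrightarrow> 0"
proof (rule tendstoI)
  fix e :: real
  assume "e > 0"
  then have "e / 2 > 0"
    by simp
  then obtain g :: "'a \<Rightarrow>\<^sub>L real" and l
    where l: "l > 0" and small: "\<And>x. x \<in> A \<Longrightarrow> g x < l \<Longrightarrow> \<bar>f x\<bar> < e / 2"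
    using slice_base_at_0_obtains_functional[OF base \<open>0 \<in> A\<close>] by metis
  have sum_lim: "(\<lambda>n. h (a n) + h (b n)) \<longlonglongrightarrow> 0" for h :: "'a \<Rightarrow>\<^sub>L real"
    using blinfun.tendsto[OF tendsto_const[of h] lim] by (simp add: blinfun.add_right)
  have "\<forall>\<^sub>F n in sequentially. g (a n) + g (b n) < 2 * l"
    using order_tendstoD(2)[OF sum_lim] l by simp
  moreover have "\<forall>\<^sub>F n in sequentially. \<bar>f (a n) + f (b n)\<bar> < e / 2"
    using tendstoD[OF sum_lim, of "e / 2" f] \<open>e > 0\<close> by simp
  ultimately show "\<forall>\<^sub>F n in sequentially. dist (f (a n)) 0 < e"
  proof eventually_elim
    case (elim n)
    then consider "g (a n) < l" | "g (b n) < l" by linarith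
    then have "\<bar>f (a n)\<bar> < e / 2 \<or> \<bar>f (b n)\<bar> < e / 2"
      using small A by blast
    with elim(2) have "\<bar>f (a n)\<bar> < e"
      by linarith
    then show ?case
      by simp
  qed
qed

theorem theorem3:
  fixes C :: "'a::real_normed_vector set" and R :: real
  assumes "pointed_cone C" and "R > 0"
    and "neighbourhood_base_at 0
           (\<lambda>S. open_slice (C \<inter> cball 0 R) S \<and> 0 \<in> S)
           (subtopology weak_topology (C \<inter> cball 0 R))"
  shows "locally_weakly_strongly_extreme_point 0 C"
proof -
  have "0 \<in> C"
    using assms(1) unfolding pointed_cone_def by blast
  moreover have "0 \<in> interior (cball (0::'a) R)"
    using \<open>R > 0\<close> by (intro interiorI[of "ball 0 R"]) auto
  moreover have "limitin weak_topology a 0 sequentially"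
    if "\<forall>n. a n \<in> C \<inter> cball 0 R" "\<forall>n. b n \<in> C \<inter> cball 0 R" "(\<lambda>n. a n + b n) \<longlonglongrightarrow> 0"
    for a b :: "nat \<Rightarrow> 'a"
  proof (rule limitin_weak_topologyI)
    fix f :: "'a \<Rightarrow>\<^sub>L real"
    have "0 \<in> C \<inter> cball 0 R"
      using \<open>0 \<in> C\<close> \<open>R > 0\<close> by simp
    then have "(\<lambda>n. f (a n)) \<longlonglongrightarrow> 0"
      using functional_tendsto_0_if_slice_base[OF assms(3)] that by blast
    then show "(\<lambda>n. f (a n)) \<longlonglongrightarrow> f 0"
      by simp
  qed
  ultimately show ?thesis
    unfolding locally_weakly_strongly_extreme_point_def scaleR_zero_right by blast
qed

end
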